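(* Let $H$ be a real Hilbert space and let $K$ be a cone in $H$. Let $T \in \mathcal{B}(H)$ and $b \in H$. If $m_r(T)>0$, then $$SOL(T,b)\cap R(T^* ) \subseteq B\Big(0, \frac{\|b\|}{m_r(T)}\Big) \cap K,$$ where $B(0,r)=\{x\in H: \|x\|\le r\}$.
   Context: $\mathcal{B}(H)$ is the set of bounded linear operators on $H$; $T^*$ is the adjoint of $T$ and $R(\cdot)$ denotes range. A subset $K\subseteq H$ is a cone if $x,y\in K$ and $\lambda\ge 0$ imply $x+y\in K$ and $\lambda x\in K$, and $K\cap(-K)=\{0\}$. Its dual cone is $K^*=\{y\in H: \langle y,x\rangle\ge 0 \text{ for all } x\in K\}$ (continuous linear functionals on $H$ being identified with vectors of $H$). The linear complementarity problem $LCP(T,b)$ (with respect to $K$) is to find $z\in K$ such that $Tz+b\in K^*$ and $\langle z,Tz+b\rangle=0$; $SOL(T,b)$ is the set of all its solutions. Define $m_r(T)=\inf\{\langle Tx,x\rangle : x\in R(T^* ),\ \|x\|=1\}$. *)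

theory Defs
  imports "HOL-Analysis.Analysis"
begin

text \<open>
  A real Hilbert space is a type of sort \<open>{real_inner, complete_space}\<close>.  The adjoint is the
  library's \<^const>\<open>adjoint\<close>, a Hilbert choice of a function \<open>S\<close> with \<open>T x \<bullet> y = x \<bullet> S y\<close>; for
  bounded linear \<open>T\<close> on a Hilbert space such an \<open>S\<close> exists and is unique, by the Riesz
  representation theorem.
\<close>

text \<open>
  The library's \<^const>\<open>cone\<close> is not closed under addition, and its \<^const>\<open>convex_cone\<close> need not
  be pointed.  No topological closedness is required; \<open>0 \<in> K\<close> follows from the last conjunct.
\<close>

definition pointed_cone :: "'a::real_vector set \<Rightarrow> bool" where
  "pointed_cone K \<longleftrightarrow>
     (\<forall>x\<in>K. \<forall>y\<in>K. \<forall>c\<ge>0. x + y \<in> K \<and> c *\<^sub>R x \<in> K) \<and> K \<inter> uminus ` K = {0}"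

definition dual_cone :: "'a::real_inner set \<Rightarrow> 'a set" where
  "dual_cone K = {y. \<forall>x\<in>K. y \<bullet> x \<ge> 0}"

definition SOL :: "'a::real_inner set \<Rightarrow> ('a \<Rightarrow> 'a) \<Rightarrow> 'a \<Rightarrow> 'a set" where
  "SOL K T b = {z \<in> K. T z + b \<in> dual_cone K \<and> z \<bullet> (T z + b) = 0}"

text \<open>
  The infimum is taken in \<^typ>\<open>ereal\<close> so that it is \<open>\<infinity>\<close> when \<open>range (adjoint T) = {0}\<close>,
  i.e. when \<open>T = 0\<close> (the infimum of the empty set of reals is unspecified in HOL).  For nonzero
  bounded linear \<open>T\<close> the value is finite and equals the real infimum.
\<close>

definition m_r :: "('a::real_inner \<Rightarrow> 'a) \<Rightarrow> ereal" where
  "m_r T = (INF x\<in>{x \<in> range (adjoint T). norm x = 1}. ereal (T x \<bullet> x))"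

text \<open>
  The closed ball around the origin, with a radius in \<^typ>\<open>ereal\<close>; for \<open>r = ereal s\<close> it
  is \<open>cball 0 s\<close>.  In \<^typ>\<open>ereal\<close>, \<open>ereal s / \<infinity> = 0\<close>.
\<close>

definition origin_ball :: "ereal \<Rightarrow> 'a::real_normed_vector set" where
  "origin_ball r = {x. ereal (norm x) \<le> r}"

lemma origin_ball_ereal: "origin_ball (ereal s) = cball 0 s"
  by (auto simp: origin_ball_def)

lemma m_r_eq_real_Inf:
  fixes T :: "'a::real_inner \<Rightarrow> 'a"
  assumes "bounded_linear T" and "{x \<in> range (adjoint T). norm x = 1} \<noteq> {}"
  shows "m_r T = ereal (INF x\<in>{x \<in> range (adjoint T). norm x = 1}. T x \<bullet> x)"
proof -
  have "- onorm T \<le> T x \<bullet> x" if "norm x = 1" for x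
    using Cauchy_Schwarz_ineq2[of "T x" x] onorm[OF assms(1), of x] that by simp
  then have "bdd_below ((\<lambda>x. T x \<bullet> x) ` {x \<in> range (adjoint T). norm x = 1})"
    by (intro bdd_belowI[of _ "- onorm T"]) auto
  from ereal_Inf'[OF this] assms(2) show ?thesis
    by (simp add: m_r_def image_image)
qed

end

theory Submission
  imports Defs
begin

text \<open>
  If \<open>z\<close> is a nonzero solution in \<open>R(T*)\<close>, complementarity and Cauchy--Schwarz give
  \<open>\<langle>Tz, z\<rangle> = -\<langle>b, z\<rangle> \<le> \<parallel>b\<parallel> \<parallel>z\<parallel>\<close>, while normalising \<open>z\<close> inside the subspace \<open>R(T*)\<close> gives
  \<open>m\<^sub>r(T) \<parallel>z\<parallel>\<^sup>2 \<le> \<langle>Tz, z\<rangle>\<close>.  That \<open>R(T*)\<close> is a subspace needs the existence of the adjoint, hence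
  the Riesz representation theorem; the representing vector is found as the minimiser of
  \<open>\<parallel>x\<parallel>\<^sup>2 - 2 f(x)\<close>, minimising sequences being Cauchy by the parallelogram identity.
\<close>

lemma Riesz_representation:
  fixes f :: "'a::{real_inner, complete_space} \<Rightarrow> real"
  assumes "bounded_linear f"
  obtains u where "\<And>x. f x = u \<bullet> x"
proof -
  interpret f: bounded_linear f by fact
  define J where "J x = x \<bullet> x - 2 * f x" for x
  define d where "d = (INF x. J x)"
  have bdd: "bdd_below (range J)"
  proof (rule bdd_belowI[of _ "- (onorm f)\<^sup>2"], clarify)
    fix x
    have "f x \<le> onorm f * norm x"
      using onorm[OF assms, of x] by simp
    moreover have "0 \<le> (norm x - onorm f)\<^sup>2"
      by simp
    ultimately show "- (onorm f)\<^sup>2 \<le> J x"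
      by (simp add: J_def power2_diff dot_square_norm algebra_simps)
  qed
  have d_le: "d \<le> J x" for x
    unfolding d_def by (rule cINF_lower[OF bdd]) simp
  \<comment> \<open>The terms in \<open>f\<close> cancel in the parallelogram identity, and
    \<open>J\<close> at the midpoint is at least \<open>d\<close>.\<close>
  have parallelogram: "(norm (x - y))\<^sup>2 \<le> 2 * (J x - d) + 2 * (J y - d)" for x y
  proof -
    have "4 * J ((1/2) *\<^sub>R (x + y)) = 2 * J x + 2 * J y - (norm (x - y))\<^sup>2"
      by (simp add: J_def f.scaleR f.add dot_square_norm[symmetric] inner_add_left inner_add_right
          inner_diff_left inner_diff_right inner_commute algebra_simps)
    then show ?thesis
      using d_le[of "(1/2) *\<^sub>R (x + y)"] by argo
  qed
  have "\<exists>x. J x < d + 1 / real (Suc n)" for n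
    using cINF_less_iff[OF _ bdd, of "d + 1 / real (Suc n)"] by (auto simp: d_def)
  then obtain X where X: "\<And>n. J (X n) < d + 1 / real (Suc n)"
    by metis
  have "Cauchy X"
  proof (rule metric_CauchyI)
    fix e :: real assume "e > 0"
    \<comment> \<open>Each of the two excesses over \<open>d\<close> enters
      \<open>parallelogram\<close> with factor 2, so \<open>e\<^sup>2 / 4\<close> is what each may
      contribute.\<close>
    then obtain N where N: "1 / real (Suc N) < e\<^sup>2 / 4"
      using nat_approx_posE[of "e\<^sup>2 / 4"] by auto
    have "dist (X m) (X n) < e" if "m \<ge> N" "n \<ge> N" for m n
    proof -
      have J_less: "J (X k) < d + e\<^sup>2 / 4" if "k \<ge> N" for k
      proof -
        have "1 / real (Suc k) \<le> 1 / real (Suc N)"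
          using that by (simp add: frac_le)
        then show ?thesis
          using X[of k] N by linarith
      qed
      have "(norm (X m - X n))\<^sup>2 < e\<^sup>2"
        using parallelogram[of "X m" "X n"] J_less[OF that(1)] J_less[OF that(2)] by argo
      then show ?thesis
        using \<open>e > 0\<close> by (simp add: dist_norm power_less_imp_less_base)
    qed
    then show "\<exists>M. \<forall>m\<ge>M. \<forall>n\<ge>M. dist (X m) (X n) < e" by blast
  qed
  then obtain u where u: "X \<longlonglongrightarrow> u"
    using Cauchy_convergent convergent_def by blast
  have "(\<lambda>n. J (X n)) \<longlonglongrightarrow> J u"
    unfolding J_def by (intro tendsto_intros f.tendsto u)
  moreover have "(\<lambda>n. d + 1 / real (Suc n)) \<longlonglongrightarrow> d + 0"
    using LIMSEQ_inverse_real_of_nat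
    by (intro tendsto_intros) (simp add: inverse_eq_divide)
  ultimately have min: "J u \<le> d"
    using X by (intro LIMSEQ_le[of "\<lambda>n. J (X n)"]) (auto intro: less_imp_le)
  have "f v = u \<bullet> v" for v
  proof (cases "v = 0")
    case False
    define g where "g = f v - u \<bullet> v"
    \<comment> \<open>This \<open>t\<close> minimises \<open>J\<close> on the line through
      \<open>u\<close> in direction \<open>v\<close>; there \<open>J\<close> drops by
      \<open>t * g\<close>, that is \<open>g\<^sup>2 / (v \<bullet> v)\<close>, so minimality of
      \<open>u\<close> forces \<open>g = 0\<close>.\<close>
    define t where "t = g / (v \<bullet> v)"
    have "J (u + t *\<^sub>R v) = J u - 2 * (t * g) + t * (t * (v \<bullet> v))"
      by (simp add: J_def g_def f.add f.scaleR inner_add_left inner_add_right inner_commute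
          algebra_simps)
    also have "t * (v \<bullet> v) = g"
      using False by (simp add: t_def)
    finally have "t * g \<le> 0"
      using min d_le[of "u + t *\<^sub>R v"] by linarith
    then have "g * g \<le> 0"
      using False by (auto simp: t_def divide_le_0_iff dest: antisym[OF _ inner_ge_zero])
    then show ?thesis
      by (auto simp: g_def mult_le_0_iff)
  qed (simp add: f.zero)
  then show ?thesis using that by blast
qed

text \<open>The Hilbert choice in \<open>adjoint\<close> satisfies its specification once some
  witness exists; Riesz applied to \<open>\<lambda>x. T x \<bullet> y\<close> supplies one for each
  \<open>y\<close>.\<close>

lemma adjoint_inner_Hilbert:
  fixes T :: "'a::{real_inner, complete_space} \<Rightarrow> 'b::real_inner"
  assumes "bounded_linear T"
  shows "T x \<bullet> y = x \<bullet> adjoint T y"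
proof -
  have "\<exists>u. \<forall>x. T x \<bullet> y = x \<bullet> u" for y
    using Riesz_representation[OF bounded_linear_compose[OF bounded_linear_inner_left assms], of y]
    by (metis inner_commute)
  then have "\<exists>S. \<forall>x y. T x \<bullet> y = x \<bullet> S y"
    by metis
  then show ?thesis
    unfolding adjoint_def by (rule someI2_ex) blast
qed

text \<open>Vectors with the same inner products against every vector coincide, and moving
  \<open>adjoint T\<close> across turns these products into ones with \<open>T\<close>.\<close>

lemma linear_adjoint_Hilbert:
  fixes T :: "'a::{real_inner, complete_space} \<Rightarrow> 'b::real_inner"
  assumes "bounded_linear T"
  shows "linear (adjoint T)"
  by (rule linearI; rule vector_eq_ldot[THEN iffD1])
    (simp_all add: inner_add_right adjoint_inner_Hilbert[OF assms, symmetric])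

lemma m_r_le_Rayleigh:
  fixes T :: "'a::{real_inner, complete_space} \<Rightarrow> 'a"
  assumes "bounded_linear T" "z \<in> range (adjoint T)" "z \<noteq> 0"
  shows "m_r T \<le> ereal ((T z \<bullet> z) / (norm z)\<^sup>2)"
proof -
  let ?w = "(1 / norm z) *\<^sub>R z"
  have "?w \<in> range (adjoint T)"
    using assms(2) linear_adjoint_Hilbert[OF assms(1)]
    by (intro subspace_scale linear_subspace_image) auto
  then have "m_r T \<le> ereal (T ?w \<bullet> ?w)"
    unfolding m_r_def using assms(3) by (intro INF_lower) auto
  then show ?thesis
    using bounded_linear.linear[OF assms(1)] by (simp add: linear_scale power2_eq_square)
qed

theorem theorem4p2:
  fixes T :: "'a::{real_inner, complete_space} \<Rightarrow> 'a"
    and K :: "'a set"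
    and b :: 'a
  assumes "pointed_cone K"
    and "bounded_linear T"
    and "m_r T > 0"
  shows "SOL K T b \<inter> range (adjoint T) \<subseteq> origin_ball (ereal (norm b) / m_r T) \<inter> K"
proof
  fix z assume z: "z \<in> SOL K T b \<inter> range (adjoint T)"
  then have "z \<in> K" and compl: "z \<bullet> (T z + b) = 0"
    by (auto simp: SOL_def)
  have "ereal (norm z) \<le> ereal (norm b) / m_r T"
  proof (cases "z = 0")
    case True
    then show ?thesis
      \<comment> \<open>The value \<open>\<infinity>\<close> can occur here, when
        \<open>T = 0\<close>; the radius is then 0.\<close>
      using assms(3) by (cases "m_r T") auto
  next
    case False
    have "T z \<bullet> z \<le> norm b * norm z"
      using compl Cauchy_Schwarz_ineq2[of b z] by (simp add: inner_add_right inner_commute)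
    then have "(T z \<bullet> z) / (norm z)\<^sup>2 \<le> norm b / norm z"
      using False by (simp add: power2_eq_square field_simps)
    then have "m_r T \<le> ereal (norm b / norm z)"
      using m_r_le_Rayleigh[OF assms(2) _ False] z by (force intro: order_trans)
    \<comment> \<open>A positive \<open>m_r T\<close> with a real upper bound is finite, so the
      inequality can be rearranged over the reals.\<close>
    then show ?thesis
      using assms(3) False by (cases "m_r T") (auto simp: field_simps)
  qed
  with \<open>z \<in> K\<close> show "z \<in> origin_ball (ereal (norm b) / m_r T) \<inter> K"
    by (simp add: origin_ball_def)
qed

end
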